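(* For every free group $F$ (with a fixed well-ordered, symmetric, free generating set), there is a collection of effective words $B\subset F$ such that the associated set $\{\phi_w\}_{w\in B}$ of homogeneous counting quasimorphisms is linearly independent. Further, for every homogeneous quasimorphism $\phi$ on $F$, there are real numbers $\{r_w\}_{w\in B}\subset\mathbf{R}$ such that $\phi=\sum_{w\in B} r_w\phi_w$.
   Context: $F$ is a free group, possibly of infinite rank. Fix a well-ordered, symmetric, free generating set of $F$ (i.e. $X\cup X^{-1}$ for a free basis $X$, equipped with a well-ordering) and equip $F$ (viewed as reduced words) with the lexicographical order. For a cyclically reduced word $w$, $[w]$ is the finite set of conjugates of $w$ obtained by cyclically permuting its letters. A nontrivial word $w$ is indivisible if it is not a proper power of another word. A word $w\in F$ is effective if it is indivisible and cyclically reduced, and it has minimal lexicographical order among all elements of $[w]$. For a nontrivial reduced word $w$ and $g\in F$, $C_w(g)$ is the maximum number of disjoint copies of $w$ (as subwords) in the reduced representative of $g$; $\Phi_w(g)=C_w(g)-C_{w^{-1}}(g)$; this is a quasimorphism, and the homogeneous counting quasimorphism associated to $w$ is its homogenization $\phi_w(g)=\lim_{n\to\infty}\Phi_w(g^n)/n$. A quasimorphism on $F$ is a function $\Phi:F\to\mathbf{R}$ for which there is $D\ge0$ with $|\Phi(gh)-\Phi(g)-\Phi(h)|\le D$ for all $g,h$; it is homogeneous if $\Phi(g^n)=n\Phi(g)$ for all $g\in F$, $n\in\mathbf{Z}$. Infinitely many $r_w$ may be nonzero; the identity $\phi=\sum_{w\in B}r_w\phi_w$ is understood pointwise: for each $g\in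 F$ only finitely many terms $r_w\phi_w(g)$ are nonzero and their sum equals $\phi(g)$. *)

theory Defs
  imports Complex_Main "HOL-Algebra.Group"
begin

text \<open>
  A free group is an abstract group \<open>F\<close> with a free basis \<open>X\<close>; the alphabet is
  \<open>S = X \<union> X\<inverse> \<subseteq> carrier F\<close>, so letters are themselves elements of \<open>F\<close>
  and words are lists of letters. The well-ordering of \<open>S\<close> is a reflexive relation \<open>r\<close> with
  \<open>well_order_on S r\<close>.
\<close>

subsection \<open>Free groups and reduced words\<close>

definition reduced :: "('a, 'b) monoid_scheme \<Rightarrow> 'a list \<Rightarrow> bool" where
  "reduced F xs \<longleftrightarrow> successively (\<lambda>x y. y \<noteq> inv\<^bsub>F\<^esub> x) xs"

definition reduced_words :: "('a, 'b) monoid_scheme \<Rightarrow> 'a set \<Rightarrow> 'a list set" where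
  "reduced_words F S = {xs \<in> lists S. reduced F xs}"

definition word_val :: "('a, 'b) monoid_scheme \<Rightarrow> 'a list \<Rightarrow> 'a" where
  "word_val F xs = foldr (\<lambda>x y. x \<otimes>\<^bsub>F\<^esub> y) xs \<one>\<^bsub>F\<^esub>"

text \<open>
  \<open>X\<close> is a free basis if every element of \<open>F\<close> is the value of exactly one reduced word over
  \<open>X \<union> X\<inverse>\<close>. As letters are group elements rather than formal symbols, disjointness of
  \<open>X\<close> and \<open>X\<inverse>\<close> has to be required separately; it rules out, for instance, generators of
  order two. The empty basis (trivial group) is allowed.
\<close>

definition free_basis :: "('a, 'b) monoid_scheme \<Rightarrow> 'a set \<Rightarrow> bool" where
  "free_basis F X \<longleftrightarrow> X \<subseteq> carrier F \<and> X \<inter> m_inv F ` X = {} \<and>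
     bij_betw (word_val F) (reduced_words F (X \<union> m_inv F ` X)) (carrier F)"

definition symmetric_free_generating_set :: "('a, 'b) monoid_scheme \<Rightarrow> 'a set \<Rightarrow> bool" where
  "symmetric_free_generating_set F S \<longleftrightarrow> (\<exists>X. free_basis F X \<and> S = X \<union> m_inv F ` X)"

definition red_rep :: "('a, 'b) monoid_scheme \<Rightarrow> 'a set \<Rightarrow> 'a \<Rightarrow> 'a list" where
  "red_rep F S g = (THE xs. xs \<in> reduced_words F S \<and> word_val F xs = g)"


subsection \<open>Effective words\<close>

definition lex_less ::
  "('a, 'b) monoid_scheme \<Rightarrow> 'a set \<Rightarrow> ('a \<times> 'a) set \<Rightarrow> 'a \<Rightarrow> 'a \<Rightarrow> bool" where
  "lex_less F S r g h \<longleftrightarrow> (red_rep F S g, red_rep F S h) \<in> lexord (r - Id)"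

definition cyclically_reduced :: "('a, 'b) monoid_scheme \<Rightarrow> 'a set \<Rightarrow> 'a \<Rightarrow> bool" where
  "cyclically_reduced F S w \<longleftrightarrow>
     (let xs = red_rep F S w in xs \<noteq> [] \<longrightarrow> hd xs \<noteq> inv\<^bsub>F\<^esub> (last xs))"

definition cyclic_class :: "('a, 'b) monoid_scheme \<Rightarrow> 'a set \<Rightarrow> 'a \<Rightarrow> 'a set" where
  "cyclic_class F S w = {word_val F (rotate k (red_rep F S w)) | k. True}"

definition indivisible :: "('a, 'b) monoid_scheme \<Rightarrow> 'a \<Rightarrow> bool" where
  "indivisible F w \<longleftrightarrow>
     w \<noteq> \<one>\<^bsub>F\<^esub> \<and> \<not> (\<exists>u\<in>carrier F. \<exists>n::nat. n \<ge> 2 \<and> w = u [^]\<^bsub>F\<^esub> n)"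

definition effective ::
  "('a, 'b) monoid_scheme \<Rightarrow> 'a set \<Rightarrow> ('a \<times> 'a) set \<Rightarrow> 'a \<Rightarrow> bool" where
  "effective F S r w \<longleftrightarrow> w \<in> carrier F \<and> indivisible F w \<and> cyclically_reduced F S w \<and>
     (\<forall>v\<in>cyclic_class F S w. \<not> lex_less F S r v w)"


subsection \<open>Counting quasimorphisms\<close>

text \<open>A copy of \<open>u\<close> in \<open>v\<close> is given by its starting position.\<close>

definition occurrences :: "'a list \<Rightarrow> 'a list \<Rightarrow> nat set" where
  "occurrences u v = {i. i + length u \<le> length v \<and> take (length u) (drop i v) = u}"

definition max_disjoint_copies :: "'a list \<Rightarrow> 'a list \<Rightarrow> nat" where
  "max_disjoint_copies u v = Max {card I | I. I \<subseteq> occurrences u v \<and>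
     pairwise (\<lambda>i j. i + length u \<le> j \<or> j + length u \<le> i) I}"

definition counting_fun :: "('a, 'b) monoid_scheme \<Rightarrow> 'a set \<Rightarrow> 'a \<Rightarrow> 'a \<Rightarrow> nat" where
  "counting_fun F S w g = max_disjoint_copies (red_rep F S w) (red_rep F S g)"

definition counting_qm :: "('a, 'b) monoid_scheme \<Rightarrow> 'a set \<Rightarrow> 'a \<Rightarrow> 'a \<Rightarrow> real" where
  "counting_qm F S w g = real (counting_fun F S w g) - real (counting_fun F S (inv\<^bsub>F\<^esub> w) g)"

definition hom_counting_qm :: "('a, 'b) monoid_scheme \<Rightarrow> 'a set \<Rightarrow> 'a \<Rightarrow> 'a \<Rightarrow> real" where
  "hom_counting_qm F S w g = lim (\<lambda>n. counting_qm F S w (g [^]\<^bsub>F\<^esub> (n::nat)) / real n)"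


subsection \<open>Quasimorphisms and linear independence\<close>

text \<open>Real functions on \<open>F\<close> are functions on the whole type, considered on the carrier only.\<close>

definition quasimorphism :: "('a, 'b) monoid_scheme \<Rightarrow> ('a \<Rightarrow> real) \<Rightarrow> bool" where
  "quasimorphism F \<phi> \<longleftrightarrow> (\<exists>D\<ge>0. \<forall>g\<in>carrier F. \<forall>h\<in>carrier F.
     \<bar>\<phi> (g \<otimes>\<^bsub>F\<^esub> h) - \<phi> g - \<phi> h\<bar> \<le> D)"

definition homogeneous_quasimorphism :: "('a, 'b) monoid_scheme \<Rightarrow> ('a \<Rightarrow> real) \<Rightarrow> bool" where
  "homogeneous_quasimorphism F \<phi> \<longleftrightarrow> quasimorphism F \<phi> \<and>
     (\<forall>g\<in>carrier F. \<forall>n::int. \<phi> (g [^]\<^bsub>F\<^esub> n) = of_int n * \<phi> g)"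

text \<open>
  Independence of the indexed family \<open>f w\<close>, \<open>w \<in> B\<close>, of functions on \<open>A\<close>; in particular distinct
  indices give distinct functions on \<open>A\<close>.
\<close>

definition lin_independent_family :: "'a set \<Rightarrow> 'i set \<Rightarrow> ('i \<Rightarrow> 'a \<Rightarrow> real) \<Rightarrow> bool" where
  "lin_independent_family A B f \<longleftrightarrow>
     (\<forall>T c. finite T \<longrightarrow> T \<subseteq> B \<longrightarrow> (\<forall>g\<in>A. (\<Sum>w\<in>T. c w * f w g) = 0) \<longrightarrow> (\<forall>w\<in>T. c w = 0))"

end

theory Submission
  imports Defs
begin

text \<open>
  The basis consists of Lyndon words. From each pair of mutually inverse conjugacy classes of
  indivisible elements, choose the cyclically reduced word \<open>w\<close> that is lexicographically minimal among
  all rotations of \<open>w\<close> and of \<open>w\<inverse>\<close>; as the letters are well-ordered, a minimum exists.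
  These words are the set \<open>basis_words\<close>.

  The decisive fact is that a primitive word which is minimal among its rotations has no proper
  border (\<open>minimal_rotation_unbordered\<close>). Hence two copies of such a \<open>w\<close> never overlap, so that
  \<open>C\<^sub>w\<close> counts all copies of \<open>w\<close>, and \<open>\<phi>\<^sub>w(v)\<close> is, for cyclically reduced \<open>v\<close>, the number of
  occurrences of \<open>w\<close> minus that of \<open>w\<inverse>\<close> per period of the periodic word \<open>\<dots>vvv\<dots>\<close>
  (\<open>hom_counting_qm_word\<close>). Moreover, a word longer than \<open>v\<close> inside this periodic word overlaps its
  own translate by one period and so has a border. Therefore \<open>\<phi>\<^sub>w(v) \<noteq> 0\<close> forces \<open>|w| \<le> |v|\<close>; and if
  \<open>|w| = |v|\<close>, then \<open>w\<close> or \<open>w\<inverse>\<close> is a rotation of \<open>v\<close>, which for basis words means \<open>w = v\<close>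
  (\<open>cyclic_count_diff_triangular\<close>). Finally \<open>\<phi>\<^sub>v(v) = 1\<close>, because \<open>v\<close> is primitive and no nontrivial
  element of a free group is conjugate to its inverse. Only finitely many \<open>w\<close> satisfy
  \<open>\<phi>\<^sub>w(v) \<noteq> 0\<close>, even when the rank is infinite, as \<open>w\<close> or its inverse is read off inside a rotation of \<open>v\<close>.

  So the matrix \<open>\<phi>\<^sub>w(v)\<close> with \<open>v\<close> and \<open>w\<close> in the basis is unitriangular with respect to length and
  has finite support for each \<open>v\<close>. This gives linear independence, and for a homogeneous
  quasimorphism \<open>\<phi>\<close> the equations \<open>\<phi>(v) = \<Sum>\<^sub>w r\<^sub>w \<phi>\<^sub>w(v)\<close> are solved for the coefficients by recursion
  on the length (\<open>triangular_coefficients\<close>). The equations then hold on all of the group: every nontrivial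
  element is conjugate to a power \<open>v\<^sup>m\<close> of a basis word, and there all homogeneous quasimorphisms,
  like all the functions \<open>\<phi>\<^sub>w\<close>, take \<open>m\<close> times their value at \<open>v\<close> (\<open>values_from_basis_word\<close>).
\<close>

section \<open>Occurrences in periodic words\<close>

abbreviation word_power :: "'a list \<Rightarrow> nat \<Rightarrow> 'a list" where
  "word_power u n \<equiv> concat (replicate n u)"

lemma length_word_power [simp]: "length (word_power u n) = n * length u"
  by (induction n) auto

lemma word_power_add: "word_power u (m + n) = word_power u m @ word_power u n"
  by (induction m) auto

lemma word_power_word_power: "word_power (word_power u m) n = word_power u (m * n)"
  by (induction n) (auto simp: word_power_add)

lemma nth_word_power:
  "i < n * length u \<Longrightarrow> word_power u n ! i = u ! (i mod length u)"
proof (induction n arbitrary: i)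
  case (Suc n)
  show ?case
  proof (cases "i < length u")
    case False
    then have "word_power u (Suc n) ! i = word_power u n ! (i - length u)"
      by (simp add: nth_append)
    also have "\<dots> = u ! ((i - length u) mod length u)"
      using Suc False by (intro Suc.IH) auto
    finally show ?thesis
      using False by (simp add: le_mod_geq)
  qed (simp add: nth_append)
qed simp

lemma mem_occurrences_iff:
  "i \<in> occurrences w z \<longleftrightarrow> i + length w \<le> length z \<and> (\<forall>j<length w. z ! (i + j) = w ! j)"
  by (auto simp: occurrences_def list_eq_iff_nth_eq)

lemma finite_occurrences: "finite (occurrences w z)"
  by (rule finite_subset[of _ "{..length z}"]) (auto simp: mem_occurrences_iff)

definition occurs_cyclically :: "'a list \<Rightarrow> 'a list \<Rightarrow> nat \<Rightarrow> bool" where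
  "occurs_cyclically w u i \<longleftrightarrow> (\<forall>j<length w. w ! j = u ! ((i + j) mod length u))"

text \<open>
  The number of occurrences, per period, of \<open>w\<close> in the bi-infinite word \<open>\<dots>uuu\<dots>\<close>. It may be
  nonzero even when \<open>w\<close> is longer than \<open>u\<close>.
\<close>

definition cyclic_count :: "'a list \<Rightarrow> 'a list \<Rightarrow> nat" where
  "cyclic_count w u = (\<Sum>i<length u. of_bool (occurs_cyclically w u i))"

lemma occurs_cyclically_period: "occurs_cyclically w u (i + length u) = occurs_cyclically w u i"
proof -
  have "(i + length u + j) mod length u = (i + j) mod length u" for j
    by (metis add.assoc add.commute mod_add_self2)
  then show ?thesis by (simp add: occurs_cyclically_def)
qed

lemma sum_periodic:
  fixes P :: "nat \<Rightarrow> bool"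
  assumes "\<And>i. P (i + n) = P i"
  shows "(\<Sum>i<N * n. of_bool (P i)) = N * (\<Sum>i<n. of_bool (P i) :: nat)"
proof -
  have per: "P (i + m * n) = P i" for i m
  proof (induction m)
    case (Suc m)
    show ?case using assms[of "i + m * n"] Suc by (simp add: add.commute add.left_commute)
  qed simp
  have "(\<Sum>i\<in>{m * n..<m * n + n}. of_bool (P i)) = (\<Sum>i<n. of_bool (P i) :: nat)" for m
  proof -
    have "(\<Sum>i\<in>{m * n..<m * n + n}. of_bool (P i) :: nat)
        = (\<Sum>i\<in>{0..<n}. of_bool (P (i + m * n)))"
      using sum.shift_bounds_nat_ivl[of "\<lambda>i. of_bool (P i) :: nat" 0 "m * n" n]
      by (simp add: add.commute)
    then show ?thesis by (simp only: per atLeast0LessThan)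
  qed
  then have "(\<Sum>m<N. \<Sum>i\<in>{m * n..<m * n + n}. of_bool (P i)) = N * (\<Sum>i<n. of_bool (P i) :: nat)"
    by simp
  then show ?thesis by (simp only: sum.nat_group)
qed

text \<open>
  Occurrences in a power of \<open>u\<close> with fixed ends are counted by \<open>cyclic_count\<close> up to an error that
  does not depend on the exponent, since only occurrences meeting the ends are miscounted.
\<close>

lemma card_occurrences_word_power:
  "\<bar>real (card (occurrences w (p @ word_power u N @ q))) - real N * real (cyclic_count w u)\<bar>
     \<le> real (length p + length q + length w + 1)"
proof -
  define L where "L = N * length u"
  define z where "z = p @ word_power u N @ q"
  define A where "A = occurrences w z"
  define B where "B = {i. i < L \<and> occurs_cyclically w u i}"
  have len: "length z = length p + L + length q"
    by (simp add: z_def L_def)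
  have nth: "z ! (length p + i) = u ! (i mod length u)" if "i < L" for i
    using that by (simp add: z_def L_def nth_append nth_word_power)
  have "(\<Sum>i<L. of_bool (occurs_cyclically w u i)) = N * cyclic_count w u"
    unfolding L_def cyclic_count_def
    by (rule sum_periodic) (rule occurs_cyclically_period)
  then have cardB: "card B = N * cyclic_count w u"
    by (simp add: B_def Int_def)
  have mid: "length p + i \<in> A \<longleftrightarrow> occurs_cyclically w u i" if "i + length w \<le> L" for i
    using that nth
    by (auto simp: A_def mem_occurrences_iff len occurs_cyclically_def add.assoc)
  have [simp]: "finite A" "finite B"
    by (auto simp: A_def B_def finite_occurrences)
  \<comment> \<open>Apart from the occurrences inside the power there are only those that start in \<open>p\<close> and those that
    reach into \<open>q\<close>. The extra position at the left end of the last interval matters only for empty \<open>w\<close>.\<close>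
  have "A \<subseteq> (\<lambda>i. length p + i) ` B \<union> {..<length p} \<union>
      {length p + L - length w..<length p + L + length q + 1 - length w}"
    (is "_ \<subseteq> ?I \<union> ?P \<union> ?Q")
  proof
    fix a assume a: "a \<in> A"
    then have le: "a + length w \<le> length p + L + length q"
      by (simp add: A_def mem_occurrences_iff len)
    show "a \<in> ?I \<union> ?P \<union> ?Q"
    proof (cases "length p \<le> a \<and> a + length w \<le> length p + L \<and> a < length p + L")
      case True
      then obtain i where i: "a = length p + i"
        using le_Suc_ex by blast
      with True mid[of i] a have "i \<in> B" by (simp add: B_def)
      with i show ?thesis by blast
    qed (use le in auto)
  qed
  then have "card A \<le> card (?I \<union> ?P \<union> ?Q)"
    by (intro card_mono) auto
  also have "\<dots> \<le> card ?I + card ?P + card ?Q"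
    by (meson add_le_mono card_Un_le le_refl order_trans)
  also have "card ?I = card B"
    by (simp add: card_image)
  also have "card B + card ?P + card ?Q \<le> card B + length p + length q + 1"
    by simp
  finally have upper: "card A \<le> card B + length p + length q + 1" .
  \<comment> \<open>Conversely, a cyclic occurrence is lost only if it overruns the right end of the power.\<close>
  have "?I \<subseteq> A \<union> {length p + L + 1 - length w..<length p + L}" (is "_ \<subseteq> _ \<union> ?E")
  proof
    fix a assume "a \<in> ?I"
    then obtain i where i: "a = length p + i" "i \<in> B" by blast
    show "a \<in> A \<union> ?E"
      using i mid[of i] by (cases "i + length w \<le> L") (auto simp: B_def)
  qed
  then have "card ?I \<le> card (A \<union> ?E)"
    by (intro card_mono) auto
  also have "\<dots> \<le> card A + card ?E" by (rule card_Un_le)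
  also have "\<dots> \<le> card A + length w" by simp
  finally have lower: "card B \<le> card A + length w"
    by (simp add: card_image)
  have "real (card A) \<le> real (card B) + length p + length q + 1"
    using upper by linarith
  moreover have "real (card B) \<le> real (card A) + length w"
    using lower by linarith
  moreover have "real (card B) = real N * real (cyclic_count w u)"
    by (simp add: cardB)
  ultimately show ?thesis
    by (simp add: A_def z_def)
qed

section \<open>Unbordered words\<close>

text \<open>
  Formulated with periods: \<open>w\<close> has the period \<open>k\<close> if and only if it has a border, that is, a common
  prefix and suffix, of length \<open>length w - k\<close>.
\<close>

definition unbordered :: "'a list \<Rightarrow> bool" where
  "unbordered w \<longleftrightarrow> (\<forall>k. 0 < k \<longrightarrow> k < length w \<longrightarrow> drop k w \<noteq> take (length w - k) w)"

definition primitive :: "'a list \<Rightarrow> bool" where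
  "primitive w \<longleftrightarrow> w \<noteq> [] \<and> (\<forall>u n. 2 \<le> n \<longrightarrow> w \<noteq> word_power u n)"

lemma primitive_root:
  assumes "x \<noteq> []"
  obtains u n where "primitive u" "x = word_power u n" "n \<ge> 1"
proof -
  have "\<exists>u n. primitive u \<and> x = word_power u n \<and> n \<ge> 1"
    using assms
  proof (induction "length x" arbitrary: x rule: less_induct)
    case less
    show ?case
    proof (cases "primitive x")
      case True
      then show ?thesis by (intro exI[of _ x] exI[of _ 1]) auto
    next
      case False
      then obtain y m where y: "m \<ge> 2" "x = word_power y m"
        using less.prems by (auto simp: primitive_def)
      then have "y \<noteq> []" using less.prems by auto
      then have "length y < length x" using y by simp
      with less.hyps \<open>y \<noteq> []\<close> obtain u n where u: "primitive u" "y = word_power u n" "n \<ge> 1"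
        by blast
      then have "x = word_power u (n * m)"
        using y by (simp add: word_power_word_power)
      with u y show ?thesis
        by (intro exI[of _ u] exI[of _ "n * m"]) auto
    qed
  qed
  then show ?thesis using that by blast
qed

lemma primitive_append_commute:
  assumes "primitive (x @ y)" "x @ y = y @ x"
  shows "x = [] \<or> y = []"
  proof (rule ccontr)
  assume "\<not> (x = [] \<or> y = [])"
  then obtain n zs where "1 < n" "word_power zs n = x @ y"
    using comm_append_is_replicate[of x y] assms by auto
  then have "2 \<le> n" "x @ y = word_power zs n" by auto
  with assms(1) show False unfolding primitive_def by blast
qed

lemma primitive_rotate_neq:
  assumes "primitive w" "0 < i" "i < length w"
  shows "rotate i w \<noteq> w"
proof
  assume "rotate i w = w"
  then have "drop i w @ take i w = take i w @ drop i w"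
    using assms by (simp add: rotate_drop_take)
  then show False
    using primitive_append_commute[of "take i w" "drop i w"] assms by auto
qed

lemma rotate_back:
  obtains j where "rotate j (rotate k w) = w"
proof
  define a and b where a_b_def: "a = take (k mod length w) w" "b = drop (k mod length w) w"
  have "rotate (length b) (b @ a) = a @ b" by (rule rotate_append)
  then show "rotate (length (drop (k mod length w) w)) (rotate k w) = w"
    by (simp add: a_b_def rotate_drop_take)
qed

lemma primitive_rotate:
  assumes "primitive w"
  shows "primitive (rotate k w)"
  unfolding primitive_def
proof (intro conjI allI impI notI)
  fix u and n :: nat
  assume n: "2 \<le> n" and eq: "rotate k w = word_power u n"
  obtain j where "rotate j (rotate k w) = w" by (rule rotate_back)
  then have "w = rotate j (rotate k w)" by simp
  also have "\<dots> = rotate j (word_power u n)" by (simp add: eq)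
  also have "\<dots> = word_power (rotate j u) n"
  proof (induction j)
    case (Suc j)
    have "rotate1 (word_power v n) = word_power (rotate1 v) n" for v :: "'a list"
    proof (cases v)
      case (Cons a s)
      have "word_power (a # s) m @ [a] = a # word_power (s @ [a]) m" for m
        by (induction m) auto
      then show ?thesis using n Cons by (cases n) (auto)
    qed (use n in auto)
    then show ?case using Suc by simp
  qed simp
  finally show False using assms n by (auto simp: primitive_def)
qed (use assms in \<open>auto simp: primitive_def\<close>)

lemma unbordered_occurrences_disjoint:
  assumes "unbordered w" "i \<in> occurrences w z" "j \<in> occurrences w z" "i < j"
  shows "i + length w \<le> j"
proof (rule ccontr)
  assume "\<not> i + length w \<le> j"
  define k where "k = j - i"
  have k: "0 < k" "k < length w" "j = i + k"
    using assms \<open>\<not> i + length w \<le> j\<close> by (auto simp: k_def)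
  have "w ! (k + m) = w ! m" if "m < length w - k" for m
  proof -
    have "w ! (k + m) = z ! (i + (k + m))"
      using assms(2) that by (auto simp: mem_occurrences_iff)
    also have "\<dots> = w ! m"
      using assms(3) that k by (auto simp: mem_occurrences_iff add.assoc)
    finally show ?thesis .
  qed
  then have "drop k w = take (length w - k) w"
    using k by (auto simp: list_eq_iff_nth_eq)
  with assms(1) k show False by (auto simp: unbordered_def)
qed

lemma max_disjoint_copies_unbordered:
  assumes "unbordered w"
  shows "max_disjoint_copies w z = card (occurrences w z)"
  unfolding max_disjoint_copies_def
proof (rule Max_eqI)
  have "{card I |I. I \<subseteq> occurrences w z \<and> pairwise (\<lambda>i j. i + length w \<le> j \<or> j + length w \<le> i) I}
      \<subseteq> card ` Pow (occurrences w z)" by auto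
  then show "finite {card I |I. I \<subseteq> occurrences w z \<and>
      pairwise (\<lambda>i j. i + length w \<le> j \<or> j + length w \<le> i) I}"
    by (rule finite_subset) (simp add: finite_occurrences)
  have "pairwise (\<lambda>i j. i + length w \<le> j \<or> j + length w \<le> i) (occurrences w z)"
    unfolding pairwise_def by (metis assms linorder_neqE_nat unbordered_occurrences_disjoint)
  then show "card (occurrences w z) \<in> {card I |I. I \<subseteq> occurrences w z \<and>
      pairwise (\<lambda>i j. i + length w \<le> j \<or> j + length w \<le> i) I}" by blast
qed (auto intro: card_mono finite_occurrences)

text \<open>
  Every factor of a \<open>u\<close>-periodic word agrees with its translate by \<open>length u\<close>; if it is longer than
  \<open>u\<close>, the overlap with the translate is a border.
\<close>

lemma unbordered_cyclic_count_length:
  assumes "unbordered w" "cyclic_count w u \<noteq> 0"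
  shows "length w \<le> length u"
proof (rule ccontr)
  assume "\<not> length w \<le> length u"
  from assms(2) obtain i where i: "i < length u" "occurs_cyclically w u i"
    by (auto simp: cyclic_count_def)
  have "w ! (length u + m) = w ! m" if "m < length w - length u" for m
  proof -
    have "(i + (length u + m)) mod length u = (i + m) mod length u"
      by (metis add.left_commute mod_add_self1)
    then show ?thesis
      using i that by (auto simp: occurs_cyclically_def)
  qed
  then have "drop (length u) w = take (length w - length u) w"
    using \<open>\<not> length w \<le> length u\<close> by (auto simp: list_eq_iff_nth_eq)
  moreover have "0 < length u" using i by linarith
  ultimately show False
    using assms(1) \<open>\<not> length w \<le> length u\<close> by (auto simp: unbordered_def)
qed

lemma occurs_cyclically_iff_take_rotate:
  assumes "length w \<le> length u"
  shows "occurs_cyclically w u i \<longleftrightarrow> w = take (length w) (rotate i u)"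
  using assms by (auto simp: occurs_cyclically_def list_eq_iff_nth_eq nth_rotate)

lemma cyclic_count_self:
  assumes "primitive w"
  shows "cyclic_count w w = 1"
proof -
  have "w \<noteq> []" using assms by (simp add: primitive_def)
  have "occurs_cyclically w w i \<longleftrightarrow> i = 0" if "i < length w" for i
    using primitive_rotate_neq[OF assms, of i] that
    by (cases "i = 0") (auto simp: occurs_cyclically_iff_take_rotate)
  then have "cyclic_count w w = (\<Sum>i<length w. of_bool (i = 0))"
    unfolding cyclic_count_def by (intro sum.cong) auto
  also have "\<dots> = card ({..<length w} \<inter> {i. i = 0})"
    by (subst sum_of_bool_eq) auto
  also have "{..<length w} \<inter> {i. i = 0} = {0}" using \<open>w \<noteq> []\<close> by auto
  finally show ?thesis by simp
qed

lemma cyclic_count_rotate: "cyclic_count w (rotate k u) = cyclic_count w u"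
proof (induction k)
  case (Suc k)
  define v where "v = rotate k u"
  have "cyclic_count w (rotate1 v) = cyclic_count w v"
  proof (cases "length v")
    case (Suc m)
    have "occurs_cyclically w (rotate1 v) i = occurs_cyclically w v (Suc i)" for i
    proof -
      have "rotate1 v ! ((i + j) mod length v) = v ! ((Suc i + j) mod length v)" for j
        using Suc by (simp add: nth_rotate1 mod_Suc_eq)
      then show ?thesis by (simp add: occurs_cyclically_def)
    qed
    then have "cyclic_count w (rotate1 v) = (\<Sum>i<Suc m. of_bool (occurs_cyclically w v (Suc i)))"
      by (simp add: cyclic_count_def Suc del: sum.lessThan_Suc)
    also have "\<dots> = (\<Sum>i<m. of_bool (occurs_cyclically w v (Suc i)))
        + of_bool (occurs_cyclically w v (0 + length v))"
      by (simp only: sum.lessThan_Suc Suc add_0)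
    also have "\<dots> = cyclic_count w v"
      by (simp only: occurs_cyclically_period)
        (simp only: cyclic_count_def Suc sum.lessThan_Suc_shift add.commute)
    finally show ?thesis .
  qed simp
  then show ?case using Suc by (simp add: v_def)
qed simp

text \<open>
  The order is required to be total only on the letters that occur, since a well-ordering of the
  generators says nothing about the other elements of the type.
\<close>

lemma lex_total_same_length:
  assumes "length s = length t" "total_on (set s \<union> set t) R"
  shows "s = t \<or> (s, t) \<in> lex R \<or> (t, s) \<in> lex R"
  using assms
proof (induction s t rule: list_induct2)
  case (Cons a s b t)
  then have "total_on (set s \<union> set t) R" "a = b \<or> (a, b) \<in> R \<or> (b, a) \<in> R"
    by (auto simp: total_on_def)
  with Cons show ?case by auto
qed simp

text \<open>
  If \<open>w = x @ s = t @ x\<close>, comparing \<open>w\<close> with its rotations \<open>s @ x\<close> and \<open>x @ t\<close> gives \<open>t \<le> s\<close> and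
  \<open>s \<le> t\<close>; then \<open>x\<close> and \<open>s = t\<close> commute, so \<open>w\<close> is a power.
\<close>

lemma minimal_rotation_unbordered:
  assumes prim: "primitive w"
    and min: "\<And>k. (rotate k w, w) \<notin> lex R"
    and tot: "total_on (set w) R"
  shows "unbordered w"
  unfolding unbordered_def
proof (intro allI impI notI)
  fix k assume k: "0 < k" "k < length w" and eq: "drop k w = take (length w - k) w"
  define x and t and s where x_s_t_def: "x = drop k w" "t = take k w" "s = drop (length w - k) w"
  have w: "w = t @ x" by (simp add: x_s_t_def)
  have w': "w = x @ s" by (simp add: x_s_t_def eq del: append_take_drop_id)
    (simp only: append_take_drop_id)
  have len: "length s = length t" using k by (simp add: x_s_t_def)
  have rot: "rotate k w = x @ t" "rotate (length w - k) w = s @ x"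
    using k by (simp_all add: rotate_drop_take x_s_t_def eq)
  have "(x @ t, x @ s) \<notin> lex R" using min[of k] rot w' by simp
  then have 1: "(t, s) \<notin> lex R" using lex_append_leftI by blast
  have "(s @ x, t @ x) \<notin> lex R" using min[of "length w - k"] rot w by simp
  then have 2: "(s, t) \<notin> lex R" using lex_append_rightI by blast
  have "total_on (set s \<union> set t) R"
    using tot by (rule total_on_subset) (metis Un_subset_iff inf_sup_ord(3,4) set_append w w')
  then have "s = t" using 1 2 len lex_total_same_length by blast
  then have "primitive (t @ x)" "t @ x = x @ t" using w w' prim by auto
  then have "t = [] \<or> x = []" by (rule primitive_append_commute)
  with k show False by (auto simp: x_s_t_def)
qed

section \<open>Words in a free group\<close>

locale free_group_words = group F for F :: "('a, 'b) monoid_scheme" (structure) +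
  fixes S :: "'a set"
  assumes sym_free: "symmetric_free_generating_set F S"
begin

definition inv_word :: "'a list \<Rightarrow> 'a list" where
  "inv_word xs = rev (map (m_inv F) xs)"

lemma letters_closed: "x \<in> S \<Longrightarrow> x \<in> carrier F"
  using sym_free by (auto simp: symmetric_free_generating_set_def free_basis_def)

lemma inv_letter: "x \<in> S \<Longrightarrow> inv x \<in> S"
  using sym_free by (auto simp: symmetric_free_generating_set_def free_basis_def)

lemma inv_letter_neq: "x \<in> S \<Longrightarrow> inv x \<noteq> x"
  using sym_free by (force simp: symmetric_free_generating_set_def free_basis_def)

lemma bij_word_val: "bij_betw (word_val F) (reduced_words F S) (carrier F)"
  using sym_free by (auto simp: symmetric_free_generating_set_def free_basis_def)

lemma red_rep_unique:
  assumes "xs \<in> reduced_words F S" "word_val F xs = g"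
  shows "red_rep F S g = xs"
  unfolding red_rep_def
  using assms bij_word_val by (intro the_equality) (auto simp: bij_betw_def inj_on_def)

lemma
  assumes "g \<in> carrier F"
  shows red_rep_in: "red_rep F S g \<in> reduced_words F S"
    and word_val_red_rep: "word_val F (red_rep F S g) = g"
proof -
  obtain xs where "xs \<in> reduced_words F S" "word_val F xs = g"
    using assms bij_word_val by (metis bij_betw_imp_surj_on imageE)
  with red_rep_unique show "red_rep F S g \<in> reduced_words F S" "word_val F (red_rep F S g) = g"
    by auto
qed

lemma word_val_closed: "xs \<in> lists S \<Longrightarrow> word_val F xs \<in> carrier F"
  by (induction xs) (auto simp: word_val_def letters_closed)

lemma word_val_append:
  "xs \<in> lists S \<Longrightarrow> ys \<in> lists S \<Longrightarrow> word_val F (xs @ ys) = word_val F xs \<otimes> word_val F ys"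
proof (induction xs)
  case Nil
  then show ?case using word_val_closed by (simp add: word_val_def)
next
  case (Cons x xs)
  then have "word_val F xs \<in> carrier F" "word_val F ys \<in> carrier F" "x \<in> carrier F"
    using word_val_closed letters_closed by auto
  then show ?case using Cons by (simp add: word_val_def m_assoc)
qed

lemma word_power_lists: "xs \<in> lists A \<Longrightarrow> word_power xs n \<in> lists A"
  by (induction n) auto

lemma word_val_power: "xs \<in> lists S \<Longrightarrow> word_val F (word_power xs n) = word_val F xs [^] n"
proof (induction n)
  case 0
  then show ?case by (simp add: word_val_def)
next
  case (Suc n)
  then show ?case
    using nat_pow_Suc2[OF word_val_closed[of xs], of n]
    by (simp add: word_val_append word_power_lists word_val_closed del: nat_pow_Suc in_lists_conv_set)
qed

lemma inv_word_lists: "xs \<in> lists S \<Longrightarrow> inv_word xs \<in> lists S"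
  by (auto simp: inv_word_def inv_letter)

lemma length_inv_word [simp]: "length (inv_word xs) = length xs"
  by (simp add: inv_word_def)

lemma inv_word_Nil_iff [simp]: "inv_word xs = [] \<longleftrightarrow> xs = []"
  by (simp add: inv_word_def)

lemma inv_word_append: "inv_word (xs @ ys) = inv_word ys @ inv_word xs"
  by (simp add: inv_word_def)

lemma nth_inv_word: "i < length xs \<Longrightarrow> inv_word xs ! i = inv (xs ! (length xs - Suc i))"
  by (simp add: inv_word_def rev_nth)

lemma inv_word_inv_word:
  assumes "xs \<in> lists S"
  shows "inv_word (inv_word xs) = xs"
proof -
  have "map (\<lambda>x. inv (inv x)) xs = xs"
    using assms letters_closed by (intro map_idI) auto
  then show ?thesis by (simp add: inv_word_def rev_map o_def)
qed

lemma inv_word_power: "inv_word (word_power xs n) = word_power (inv_word xs) n"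
proof (induction n)
  case (Suc n)
  have "word_power (inv_word xs) n @ inv_word xs = word_power (inv_word xs) (n + 1)"
    unfolding word_power_add by simp
  then show ?case using Suc by (simp add: inv_word_append)
qed (simp add: inv_word_def)

lemma word_val_inv_word: "xs \<in> lists S \<Longrightarrow> word_val F (inv_word xs) = inv (word_val F xs)"
proof (induction xs)
  case Nil
  then show ?case by (simp add: inv_word_def word_val_def)
next
  case (Cons x xs)
  have "inv_word (x # xs) = inv_word xs @ [inv x]" by (simp add: inv_word_def)
  then show ?case
    using Cons word_val_closed[of xs] letters_closed[of x] word_val_append[of "inv_word xs" "[inv x]"]
      inv_word_lists inv_letter
    by (simp add: inv_mult_group) (simp add: word_val_def inv_mult_group)
qed

lemma reduced_append:
  "reduced F (xs @ ys) \<longleftrightarrow> reduced F xs \<and> reduced F ys \<and>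
     (xs = [] \<or> ys = [] \<or> hd ys \<noteq> inv (last xs))"
  by (simp add: reduced_def successively_append_iff)

lemma reduced_inv_word:
  assumes "xs \<in> lists S" "reduced F xs"
  shows "reduced F (inv_word xs)"
proof -
  have "successively (\<lambda>x y. inv x \<noteq> inv (inv y)) xs"
    using assms(2) unfolding reduced_def
  proof (rule successively_mono)
    fix x y assume "x \<in> set xs" "y \<in> set xs" "y \<noteq> inv x"
    then show "inv x \<noteq> inv (inv y)"
      using assms(1) letters_closed by (metis in_lists_conv_set inv_inv)
  qed
  then show ?thesis
    by (simp add: reduced_def inv_word_def successively_map)
qed

lemma red_rep_inv:
  assumes "g \<in> carrier F"
  shows "red_rep F S (inv g) = inv_word (red_rep F S g)"
  using red_rep_in[OF assms] word_val_red_rep[OF assms]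
  by (intro red_rep_unique)
     (auto simp: reduced_words_def inv_word_lists word_val_inv_word reduced_inv_word simp del: in_lists_conv_set)

lemma card_occurrences_inv_word:
  assumes "w \<in> lists S" "z \<in> lists S"
  shows "card (occurrences (inv_word w) (inv_word z)) = card (occurrences w z)"
proof (rule bij_betw_same_card[of "\<lambda>i. length z - length w - i"])
  have reflect: "length z - length w - i \<in> occurrences (inv_word w) (inv_word z)"
    if i: "i \<in> occurrences w z" for w z i
    unfolding mem_occurrences_iff
  proof (intro conjI allI impI)
    fix j assume j: "j < length (inv_word w)"
    have "inv_word z ! (length z - length w - i + j)
        = inv (z ! (length z - Suc (length z - length w - i + j)))"
      using i j by (intro nth_inv_word) (auto simp: mem_occurrences_iff)
    also have "length z - Suc (length z - length w - i + j) = i + (length w - Suc j)"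
      using i j by (auto simp: mem_occurrences_iff)
    also have "z ! (i + (length w - Suc j)) = w ! (length w - Suc j)"
      using i j by (simp add: mem_occurrences_iff del: add_diff_assoc add_diff_assoc2)
    also have "inv \<dots> = inv_word w ! j"
      using j by (simp add: nth_inv_word)
    finally show "inv_word z ! (length z - length w - i + j) = inv_word w ! j" .
  qed (use i in \<open>auto simp: mem_occurrences_iff\<close>)
  show "bij_betw (\<lambda>i. length z - length w - i)
      (occurrences (inv_word w) (inv_word z)) (occurrences w z)"
  proof (rule bij_betw_byWitness[where f' = "\<lambda>i. length z - length w - i"])
    show "(\<lambda>i. length z - length w - i) ` occurrences (inv_word w) (inv_word z) \<subseteq> occurrences w z"
      using reflect[of _ "inv_word w" "inv_word z"] assms by (auto simp: inv_word_inv_word)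
    show "(\<lambda>i. length z - length w - i) ` occurrences w z \<subseteq> occurrences (inv_word w) (inv_word z)"
      using reflect by blast
  qed (auto simp: mem_occurrences_iff)
qed

lemma unbordered_inv_word:
  assumes "w \<in> lists S" "unbordered w"
  shows "unbordered (inv_word w)"
  unfolding unbordered_def
proof (intro allI impI notI)
  fix k assume k: "0 < k" "k < length (inv_word w)"
    and eq: "drop k (inv_word w) = take (length (inv_word w) - k) (inv_word w)"
  have 1: "drop k (inv_word w) = inv_word (take (length w - k) w)"
    using k by (simp add: inv_word_def drop_rev take_map)
  have 2: "take (length w - k) (inv_word w) = inv_word (drop k w)"
    using k by (simp add: inv_word_def take_rev drop_map)
  from eq have "inv_word (take (length w - k) w) = inv_word (drop k w)"
    using 1 2 by simp
  moreover have "take (length w - k) w \<in> lists S" "drop k w \<in> lists S"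
    using assms(1) by (auto dest: in_set_takeD in_set_dropD)
  ultimately have "take (length w - k) w = drop k w"
    by (metis inv_word_inv_word)
  with assms(2) k show False unfolding unbordered_def by (metis length_inv_word)
qed

text \<open>
  A word equal to its own inverse would have a letter that is its own inverse in the middle, or two
  mutually inverse letters there.
\<close>

lemma reduced_self_inverse:
  assumes "xs \<in> lists S" "reduced F xs" "inv_word xs = xs"
  shows "xs = []"
proof (rule ccontr)
  assume "xs \<noteq> []"
  define n where "n = length xs"
  have nth: "xs ! i = inv (xs ! (n - Suc i))" if "i < n" for i
    using nth_inv_word[of i xs] that assms(3) by (simp add: n_def)
  show False
  proof (cases "even n")
    case True
    then obtain m where m: "n = 2 * m" by blast
    with \<open>xs \<noteq> []\<close> have "m > 0" by (cases m) (auto simp: n_def)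
    have "n - Suc m = m - 1" "m < n" using m \<open>m > 0\<close> by auto
    then have "xs ! m = inv (xs ! (m - 1))" using nth[of m] by simp
    moreover have "xs ! Suc (m - 1) \<noteq> inv (xs ! (m - 1))"
    proof (rule successively_nth)
      show "successively (\<lambda>x y. y \<noteq> inv x) xs" using assms(2) by (simp add: reduced_def)
      show "Suc (m - 1) < length xs" using m \<open>m > 0\<close> by (simp add: n_def)
    qed
    ultimately show False using \<open>m > 0\<close> by simp
  next
    case False
    then obtain m where m: "n = 2 * m + 1" by (blast elim: oddE)
    have "n - Suc m = m" using m by simp
    moreover have "m < n" using m by simp
    ultimately have "xs ! m = inv (xs ! m)" using nth by metis
    moreover have "xs ! m \<in> S" using m assms(1) by (auto simp: n_def)
    ultimately show False using inv_letter_neq by metis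
  qed
qed

text \<open>
  If the inverse of \<open>x @ y\<close> is the rotation \<open>y @ x\<close>, that is, \<open>inv_word y @ inv_word x = y @ x\<close>, then
  both \<open>x\<close> and \<open>y\<close> are self-inverse, hence empty. This is the reason why no nontrivial element of a free group is conjugate to
  its inverse.
\<close>

lemma inv_word_not_rotation:
  assumes "w \<in> lists S" "reduced F w" "w \<noteq> []"
  shows "inv_word w \<noteq> rotate k w"
proof
  assume eq: "inv_word w = rotate k w"
  define x and y where x_y_def: "x = take (k mod length w) w" "y = drop (k mod length w) w"
  have w: "w = x @ y" by (simp add: x_y_def)
  have "inv_word y @ inv_word x = y @ x"
    using eq unfolding inv_word_append[symmetric] w[symmetric] by (simp add: rotate_drop_take x_y_def)
  then have "inv_word y = y" "inv_word x = x" by simp_all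
  then have "x = []" "y = []"
    using assms w reduced_self_inverse by (auto simp: reduced_append)
  then show False using w assms(3) by simp
qed

section \<open>Conjugacy normal forms\<close>

lemma hd_word_power: "n \<ge> 1 \<Longrightarrow> xs \<noteq> [] \<Longrightarrow> hd (word_power xs n) = hd xs"
  by (cases n) auto

lemma last_word_power: "n \<ge> 1 \<Longrightarrow> xs \<noteq> [] \<Longrightarrow> last (word_power xs n) = last xs"
proof (induction n)
  case (Suc n)
  then show ?case by (cases "n = 0") (auto simp: last_append)
qed simp

text \<open>
  The counterpart, for words over \<open>S\<close>, of being cyclically reduced as an element of the group. The empty
  word is included, as the core of the neutral element.
\<close>

definition cyc_reduced :: "'a list \<Rightarrow> bool" where
  "cyc_reduced x \<longleftrightarrow> x \<in> lists S \<and> reduced F x \<and> (x = [] \<or> hd x \<noteq> inv (last x))"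

lemma reduced_word_power:
  assumes "cyc_reduced x"
  shows "reduced F (word_power x n)"
proof (induction n)
  case 0
  show ?case by (simp add: reduced_def)
next
  case (Suc n)
  show ?case
  proof (cases "n = 0 \<or> x = []")
    case False
    then have "hd (word_power x n) = hd x" by (intro hd_word_power) auto
    with False Suc assms show ?thesis by (simp add: reduced_append cyc_reduced_def)
  qed (use assms in \<open>auto simp: reduced_def cyc_reduced_def\<close>)
qed

text \<open>
  Every rotation of \<open>x\<close> is a factor of the reduced word \<open>x @ x\<close>; unless the rotation is \<open>x\<close> itself, its
  last and first letters are consecutive in \<open>x\<close>.
\<close>

lemma cyc_reduced_rotate:
  assumes "cyc_reduced x"
  shows "cyc_reduced (rotate k x)"
proof (cases "x = []")
  case False
  define a and b where a_b_def: "a = take (k mod length x) x" "b = drop (k mod length x) x"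
  have x: "x = a @ b" and rot: "rotate k x = b @ a"
    by (auto simp: a_b_def rotate_drop_take)
  have "b \<noteq> []" using False by (simp add: a_b_def not_le)
  have "reduced F (x @ x)"
    using reduced_word_power[OF assms, of 2] by (simp add: numeral_2_eq_2)
  then have "reduced F (a @ (b @ a) @ b)" by (simp add: x)
  then have "reduced F (b @ a)" "a = [] \<or> hd b \<noteq> inv (last a)"
    by (auto simp: reduced_append \<open>b \<noteq> []\<close>)
  moreover have "a = [] \<Longrightarrow> rotate k x = x" using x rot by simp
  ultimately show ?thesis
    using assms x \<open>b \<noteq> []\<close> unfolding cyc_reduced_def rot by (cases "a = []") auto
qed (use assms in auto)

lemma cyc_reduced_inv_word:
  assumes "cyc_reduced x"
  shows "cyc_reduced (inv_word x)"
proof (cases "x = []")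
  case False
  have "last x \<in> S" "hd x \<in> S" using assms False by (auto simp: cyc_reduced_def)
  moreover have "hd (inv_word x) = inv (last x)" "last (inv_word x) = inv (hd x)"
    using False by (simp_all add: inv_word_def hd_rev last_rev last_map hd_map)
  ultimately show ?thesis
    using assms False letters_closed
    by (auto simp: cyc_reduced_def reduced_inv_word inv_word_lists)
qed (use assms in \<open>simp add: inv_word_def\<close>)

text \<open>Cancel inverse letters from both ends until the middle is cyclically reduced.\<close>

lemma cyc_reduced_core:
  assumes "z \<in> lists S" "reduced F z"
  obtains p x where "z = p @ x @ inv_word p" "cyc_reduced x"
proof -
  have "\<exists>p x. z = p @ x @ inv_word p \<and> cyc_reduced x"
    using assms
  proof (induction "length z" arbitrary: z rule: less_induct)
    case less
    show ?case
    proof (cases "cyc_reduced z")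
      case True
      then show ?thesis by (intro exI[of _ "[]"] exI[of _ z]) (auto simp: inv_word_def)
    next
      case False
      then have "z \<noteq> []" and hl: "hd z = inv (last z)"
        using less.prems by (auto simp: cyc_reduced_def)
      then obtain a t where z: "z = a # t" by (cases z) auto
      have "t \<noteq> []" using hl z less.prems inv_letter_neq[of a] by auto
      then obtain m b where t: "t = m @ [b]" by (cases t rule: rev_cases) auto
      have "b \<in> S" "a = inv b" using less.prems z t hl by auto
      then have b: "b = inv a" using letters_closed by simp
      have "reduced F (([a] @ m) @ [b])" using less.prems z t by simp
      then have "reduced F m" unfolding reduced_append by blast
      moreover have "m \<in> lists S" using less.prems z t by auto
      moreover have "length m < length z" by (simp add: z t)
      ultimately obtain p x where "m = p @ x @ inv_word p" "cyc_reduced x"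
        using less.hyps by blast
      then show ?thesis
        by (intro exI[of _ "a # p"] exI[of _ x]) (auto simp: z t b inv_word_def)
    qed
  qed
  then show ?thesis using that by blast
qed

lemma nat_pow_conjugate:
  assumes "h \<in> carrier F" "g \<in> carrier F"
  shows "(h \<otimes> g \<otimes> inv h) [^] (k :: nat) = h \<otimes> g [^] k \<otimes> inv h"
proof (induction k)
  case (Suc k)
  have "h \<otimes> g [^] k \<otimes> inv h \<otimes> (h \<otimes> g \<otimes> inv h) = h \<otimes> (g [^] k \<otimes> g) \<otimes> inv h"
    using assms by (simp add: m_assoc) (simp add: m_assoc[symmetric])
  then show ?case using Suc by simp
qed (use assms in simp)

text \<open>
  No letters cancel where two copies of \<open>y\<close> meet, and the ends of \<open>y\<close> meet \<open>p\<close> and its inverse in every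
  power as they do in the first one.
\<close>

lemma red_rep_conj_power:
  assumes z: "p @ word_power y n @ inv_word p \<in> reduced_words F S" and y: "cyc_reduced y"
    and "n \<ge> 1" "k \<ge> 1" and p: "y = [] \<Longrightarrow> p = []"
  shows "red_rep F S (word_val F (p @ word_power y n @ inv_word p) [^] k)
    = p @ word_power y (n * k) @ inv_word p"
proof (rule red_rep_unique)
  have pS: "p \<in> lists S" "inv_word p \<in> lists S" and yS: "y \<in> lists S"
    using z y by (auto simp: reduced_words_def cyc_reduced_def)
  show "p @ word_power y (n * k) @ inv_word p \<in> reduced_words F S"
  proof (cases "y = []")
    case True
    then show ?thesis using p z by simp
  next
    case False
    moreover have "n * k \<ge> 1" using assms(3,4) by (simp add: Suc_le_eq)
    ultimately show ?thesis
      using z pS yS reduced_word_power[OF y, of "n * k"] \<open>n \<ge> 1\<close>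
        word_power_lists[OF yS, of "n * k"]
      by (simp add: reduced_words_def reduced_append hd_word_power last_word_power hd_append last_append
          del: in_lists_conv_set append_in_lists_conv split del: if_split) 
        (auto simp: hd_word_power last_word_power hd_append last_append split: if_splits)
  qed
  define P where "P = word_val F p"
  define Y where "Y = word_val F y"
  have c: "P \<in> carrier F" "Y \<in> carrier F"
    using pS yS word_val_closed by (auto simp: P_def Y_def)
  have val: "word_val F (p @ word_power y m @ inv_word p) = P \<otimes> Y [^] m \<otimes> inv P" for m
    using pS yS c word_power_lists[OF yS, of m] 
    by (simp add: word_val_append word_val_inv_word word_val_power P_def Y_def m_assoc
        del: in_lists_conv_set)
  show "word_val F (p @ word_power y (n * k) @ inv_word p)
      = word_val F (p @ word_power y n @ inv_word p) [^] k"
    unfolding val using c by (simp add: nat_pow_conjugate nat_pow_pow)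
qed

end

section \<open>Triangular families of functions\<close>

text \<open>
  Since only finitely many \<open>f w v\<close> are nonzero for a given \<open>v\<close>, all of them with \<open>w = v\<close> or with \<open>w\<close>
  of smaller size, the equation at \<open>v\<close> determines the coefficient of \<open>v\<close> from those of smaller size.
\<close>

lemma triangular_coefficients:
  fixes f :: "'i \<Rightarrow> 'i \<Rightarrow> real" and size :: "'i \<Rightarrow> nat" and a :: "'i \<Rightarrow> real"
  assumes diag: "\<And>v. v \<in> B \<Longrightarrow> f v v = 1"
    and tri: "\<And>v w. v \<in> B \<Longrightarrow> w \<in> B \<Longrightarrow> f w v \<noteq> 0 \<Longrightarrow> w = v \<or> size w < size v"
    and fin: "\<And>v. v \<in> B \<Longrightarrow> finite {w \<in> B. f w v \<noteq> 0}"
  shows "\<exists>c. \<forall>v\<in>B. a v = (\<Sum>w | w \<in> B \<and> f w v \<noteq> 0. c w * f w v)"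
proof -
  define below where "below v = {w \<in> B. f w v \<noteq> 0 \<and> size w < size v}" for v
  have "\<exists>c. \<forall>v. c v = a v - (\<Sum>w\<in>below v. c w * f w v)"
  proof (rule dependent_wf_choice[of "measure size"])
    fix g h :: "'i \<Rightarrow> real" and v x
    assume "\<And>w. (w, v) \<in> measure size \<Longrightarrow> g w = h w"
    then have "(\<Sum>w\<in>below v. g w * f w v) = (\<Sum>w\<in>below v. h w * f w v)"
      by (intro sum.cong) (auto simp: below_def)
    then show "(x = a v - (\<Sum>w\<in>below v. g w * f w v)) = (x = a v - (\<Sum>w\<in>below v. h w * f w v))"
      by simp
  qed auto
  then obtain c where c: "\<And>v. c v = a v - (\<Sum>w\<in>below v. c w * f w v)" by blast
  have "a v = (\<Sum>w | w \<in> B \<and> f w v \<noteq> 0. c w * f w v)" if v: "v \<in> B" for v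
  proof -
    have split: "{w \<in> B. f w v \<noteq> 0} = insert v (below v)"
      using v tri diag by (auto simp: below_def)
    have "finite (below v)" "v \<notin> below v"
      using fin[OF v] unfolding split by (auto simp: below_def)
    then have "(\<Sum>w\<in>insert v (below v). c w * f w v) = c v * f v v + (\<Sum>w\<in>below v. c w * f w v)"
      by simp
    then show ?thesis
      using c[of v] by (simp add: split diag[OF v])
  qed
  then show ?thesis by blast
qed

text \<open>In a vanishing combination, evaluate at an index of minimal size among those that occur.\<close>

lemma triangular_lin_independent:
  fixes f :: "'i \<Rightarrow> 'i \<Rightarrow> real" and size :: "'i \<Rightarrow> nat"
  assumes diag: "\<And>v. v \<in> B \<Longrightarrow> f v v = 1"
    and tri: "\<And>v w. v \<in> B \<Longrightarrow> w \<in> B \<Longrightarrow> f w v \<noteq> 0 \<Longrightarrow> w = v \<or> size w < size v"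
    and "B \<subseteq> A"
  shows "lin_independent_family A B f"
  unfolding lin_independent_family_def
proof (intro allI impI ballI)
  fix T c w assume T: "finite T" "T \<subseteq> B" "\<forall>g\<in>A. (\<Sum>w\<in>T. c w * f w g) = 0" and "w \<in> T"
  from \<open>w \<in> T\<close> show "c w = 0"
  proof (induction "size w" arbitrary: w rule: less_induct)
    case less
    have w: "w \<in> B" "w \<in> A" using less.prems T \<open>B \<subseteq> A\<close> by auto
    have "c v * f v w = 0" if "v \<in> T - {w}" for v
      using that less.hyps[of v] tri[of w v] w T by auto
    then have "(\<Sum>v\<in>T. c v * f v w) = c w * f w w"
      using T(1) less.prems by (simp add: sum.remove[of T w] sum.neutral)
    then show ?case using T(3) w diag by simp
  qed
qed

section \<open>Values of homogeneous quasimorphisms\<close>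

lemma eq_if_multiples_bounded:
  fixes a b :: real
  assumes "\<And>n::nat. \<bar>real n * a - real n * b\<bar> \<le> C"
  shows "a = b"
proof (rule ccontr)
  assume "a \<noteq> b"
  then obtain n :: nat where "real n * \<bar>a - b\<bar> > C"
    using reals_Archimedean3[of "\<bar>a - b\<bar>"] by auto
  moreover have "real n * \<bar>a - b\<bar> = \<bar>real n * a - real n * b\<bar>"
    by (simp add: abs_mult flip: right_diff_distrib)
  ultimately show False using assms[of n] by linarith
qed

context free_group_words
begin

lemma homogeneous_quasimorphism_nat_pow:
  assumes "homogeneous_quasimorphism F \<phi>" "g \<in> carrier F"
  shows "\<phi> (g [^] (n::nat)) = real n * \<phi> g"
  using assms unfolding homogeneous_quasimorphism_def
  by (metis int_pow_int of_int_of_nat_eq)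

text \<open>
  Conjugation moves a quasimorphism by a bounded amount, hence a homogeneous one not at all, as one
  sees on powers.
\<close>

lemma homogeneous_quasimorphism_conjugate:
  assumes "homogeneous_quasimorphism F \<phi>" "h \<in> carrier F" "g \<in> carrier F"
  shows "\<phi> (h \<otimes> g \<otimes> inv h) = \<phi> g"
proof -
  obtain D where D: "\<And>x y. x \<in> carrier F \<Longrightarrow> y \<in> carrier F \<Longrightarrow> \<bar>\<phi> (x \<otimes> y) - \<phi> x - \<phi> y\<bar> \<le> D"
    using assms(1) unfolding homogeneous_quasimorphism_def quasimorphism_def by blast
  note pow = homogeneous_quasimorphism_nat_pow[OF assms(1)]
  show ?thesis
  proof (rule eq_if_multiples_bounded)
    fix n :: nat
    define x where "x = g [^] n"
    have x: "x \<in> carrier F" using assms by (simp add: x_def)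
    have "real n * \<phi> (h \<otimes> g \<otimes> inv h) = \<phi> (h \<otimes> x \<otimes> inv h)"
      using assms by (simp add: x_def nat_pow_conjugate flip: pow)
    moreover have "real n * \<phi> g = \<phi> x"
      using assms by (simp add: x_def pow)
    moreover have "\<bar>\<phi> (h \<otimes> x \<otimes> inv h) - \<phi> (h \<otimes> x) - \<phi> (inv h)\<bar> \<le> D" "\<bar>\<phi> (h \<otimes> x) - \<phi> h - \<phi> x\<bar> \<le> D"
      using D assms x by simp_all
    ultimately show "\<bar>real n * \<phi> (h \<otimes> g \<otimes> inv h) - real n * \<phi> g\<bar> \<le> 2 * D + \<bar>\<phi> h\<bar> + \<bar>\<phi> (inv h)\<bar>"
      by linarith
  qed
qed

lemma homogeneous_quasimorphism_inv:
  assumes "homogeneous_quasimorphism F \<phi>" "g \<in> carrier F"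
  shows "\<phi> (inv g) = - \<phi> g"
proof -
  have "\<phi> (g [^] (- 1 :: int)) = of_int (- 1) * \<phi> g"
    using assms unfolding homogeneous_quasimorphism_def by blast
  then show ?thesis using assms(2) by (simp add: int_pow_neg)
qed

lemma word_val_rotate_conjugate:
  assumes "y \<in> lists S"
  obtains h where "h \<in> carrier F" "word_val F (rotate k y) = h \<otimes> word_val F y \<otimes> inv h"
proof
  define a and b where a_b_def: "a = take (k mod length y) y" "b = drop (k mod length y) y"
  have y: "y = a @ b" and rot: "rotate k y = b @ a"
    by (simp_all add: a_b_def rotate_drop_take)
  have ab: "a \<in> lists S" "b \<in> lists S" using assms y by auto
  note c = ab[THEN word_val_closed]
  show "inv (word_val F a) \<in> carrier F" using c by simp
  show "word_val F (rotate k y) = inv (word_val F a) \<otimes> word_val F y \<otimes> inv (inv (word_val F a))"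
    using ab c unfolding rot by (simp add: y word_val_append del: in_lists_conv_set)
      (simp add: m_assoc[symmetric])
qed

text \<open>
  Every nontrivial element is conjugate, without cancellation, to a positive power of a primitive
  cyclically reduced word.
\<close>

lemma conjugacy_normal_form:
  assumes "g \<in> carrier F" "g \<noteq> \<one>"
  obtains p y n where "red_rep F S g = p @ word_power y n @ inv_word p"
    "cyc_reduced y" "primitive y" "n \<ge> 1"
proof -
  have z: "red_rep F S g \<in> lists S" "reduced F (red_rep F S g)"
    using red_rep_in[OF assms(1)] by (auto simp: reduced_words_def)
  obtain p x where px: "red_rep F S g = p @ x @ inv_word p" "cyc_reduced x"
    using cyc_reduced_core[OF z] .
  have "x \<noteq> []"
  proof
    assume "x = []"
    then have "word_val F (red_rep F S g) = word_val F p \<otimes> inv (word_val F p)"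
      using px z by (simp add: word_val_append word_val_inv_word del: in_lists_conv_set)
    moreover have "word_val F p \<in> carrier F" using px z word_val_closed by simp
    ultimately show False using assms by (simp add: word_val_red_rep)
  qed
  then obtain y n where y: "primitive y" "x = word_power y n" "n \<ge> 1"
    by (rule primitive_root)
  then have "x = y @ word_power y (n - 1)"
    by (cases n) auto
  moreover have "y \<noteq> []" using y by (simp add: primitive_def)
  ultimately have "cyc_reduced y"
    using px(2) y hd_word_power[of n y] last_word_power[of n y] \<open>x \<noteq> []\<close>
    by (auto simp: cyc_reduced_def reduced_append)
  with px y show ?thesis by (intro that) auto
qed

section \<open>Homogeneous counting quasimorphisms of unbordered words\<close>

lemma counting_qm_unbordered:
  assumes "w \<in> reduced_words F S" "unbordered w"
  shows "counting_qm F S (word_val F w) g = real (card (occurrences w (red_rep F S g)))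
    - real (card (occurrences (inv_word w) (red_rep F S g)))"
proof -
  have w: "w \<in> lists S" "reduced F w" using assms by (auto simp: reduced_words_def)
  have "red_rep F S (word_val F w) = w"
    using assms red_rep_unique by blast
  moreover from this have "red_rep F S (inv (word_val F w)) = inv_word w"
    using w by (simp add: red_rep_inv word_val_closed del: in_lists_conv_set)
  ultimately show ?thesis
    using assms(2) unbordered_inv_word[OF w(1)]
    by (simp add: counting_qm_def counting_fun_def max_disjoint_copies_unbordered)
qed

lemma counting_qm_inv:
  assumes "w \<in> reduced_words F S" "unbordered w" "g \<in> carrier F"
  shows "counting_qm F S (word_val F w) (inv g) = - counting_qm F S (word_val F w) g"
proof -
  have l: "w \<in> lists S" "red_rep F S g \<in> lists S"
    using assms red_rep_in by (auto simp: reduced_words_def)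
  show ?thesis
    using card_occurrences_inv_word[OF l] card_occurrences_inv_word[OF inv_word_lists[OF l(1)] l(2)]
    by (simp add: counting_qm_unbordered assms red_rep_inv inv_word_inv_word l
        del: in_lists_conv_set)
qed

definition cyclic_count_diff :: "'a list \<Rightarrow> 'a list \<Rightarrow> real" where
  "cyclic_count_diff w y = real (cyclic_count w y) - real (cyclic_count (inv_word w) y)"

text \<open>
  The \<open>k\<close>-th power of \<open>g\<close> reads \<open>p y\<^sup>n\<^sup>k p\<inverse>\<close>, so occurrences are counted by the number of them per
  period, up to an error that does not depend on \<open>k\<close>. The case \<open>y = []\<close> covers the neutral element.
\<close>

lemma counting_qm_power_limit:
  assumes w: "w \<in> reduced_words F S" "unbordered w"
    and g: "g \<in> carrier F" "red_rep F S g = p @ word_power y n @ inv_word p"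
    and y: "cyc_reduced y" and "n \<ge> 1" and p: "y = [] \<Longrightarrow> p = []"
  shows "(\<lambda>k. counting_qm F S (word_val F w) (g [^] k) / real k)
    \<longlonglongrightarrow> real n * cyclic_count_diff w y"
proof (rule LIM_zero_cancel)
  define C where "C = 2 * real (2 * length p + length w + 1)"
  have z: "p @ word_power y n @ inv_word p \<in> reduced_words F S"
    using red_rep_in[OF g(1)] g(2) by simp
  have bound: "norm (counting_qm F S (word_val F w) (g [^] k) / real k - real n * cyclic_count_diff w y)
      \<le> C / real k" if k: "k \<ge> 1" for k
  proof -
    define Z where "Z = p @ word_power y (n * k) @ inv_word p"
    have "word_val F (p @ word_power y n @ inv_word p) = g"
      using word_val_red_rep[OF g(1)] g(2) by simp
    then have Z: "red_rep F S (g [^] k) = Z"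
      using red_rep_conj_power[OF z y \<open>n \<ge> 1\<close> k p] by (simp add: Z_def)
    have triangle: "\<bar>a - b - (x - y)\<bar> \<le> 2 * K" if "\<bar>a - x\<bar> \<le> K" "\<bar>b - y\<bar> \<le> K" for a b x y K :: real
      using that by linarith
    have "\<bar>real (card (occurrences v Z)) - real (n * k) * real (cyclic_count v y)\<bar>
        \<le> real (2 * length p + length w + 1)" if "length v = length w" for v
      using card_occurrences_word_power[where w = v and p = p and u = y and N = "n * k" and q = "inv_word p"] that by (simp add: Z_def)
    from triangle[OF this[OF refl] this[of "inv_word w", OF length_inv_word]]
    have "\<bar>counting_qm F S (word_val F w) (g [^] k) - real (n * k) * cyclic_count_diff w y\<bar> \<le> C"
      unfolding counting_qm_unbordered[OF w] Z cyclic_count_diff_def C_def right_diff_distrib .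
    then have "\<bar>counting_qm F S (word_val F w) (g [^] k) - real (n * k) * cyclic_count_diff w y\<bar> / real k
        \<le> C / real k" by (rule divide_right_mono) simp
    moreover have "\<bar>counting_qm F S (word_val F w) (g [^] k) - real (n * k) * cyclic_count_diff w y\<bar> / real k
      = \<bar>counting_qm F S (word_val F w) (g [^] k) / real k - real n * cyclic_count_diff w y\<bar>"
    proof -
      have "\<bar>A - real (n * k) * B\<bar> / real k = \<bar>A / real k - real n * B\<bar>" for A B
      proof -
        have "\<bar>A - real (n * k) * B\<bar> / real k = \<bar>(A - real (n * k) * B) / real k\<bar>"
          by simp
        also have "(A - real (n * k) * B) / real k = A / real k - real n * B"
          using k by (simp add: field_simps)
        finally show ?thesis .
      qed
      then show ?thesis .
    qed
    ultimately show ?thesis by simp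
  qed
  show "(\<lambda>k. counting_qm F S (word_val F w) (g [^] k) / real k - real n * cyclic_count_diff w y)
      \<longlonglongrightarrow> 0"
  proof (rule tendsto_0_le[where K = 1])
    have "C \<ge> 0" by (simp add: C_def)
    show "(\<lambda>k. C / real k) \<longlonglongrightarrow> 0" by (rule lim_const_over_n)
    have "norm (counting_qm F S (word_val F w) (g [^] k) / real k - real n * cyclic_count_diff w y)
        \<le> norm (C / real k) * 1" if "k \<ge> 1" for k
      using bound[OF that] \<open>C \<ge> 0\<close> by simp
    then show "\<forall>\<^sub>F k in sequentially. norm (counting_qm F S (word_val F w) (g [^] k) / real k
        - real n * cyclic_count_diff w y) \<le> norm (C / real k) * 1"
      unfolding eventually_sequentially by blast
  qed
qed

lemma hom_counting_qm_eq:
  assumes "w \<in> reduced_words F S" "unbordered w"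
    and "g \<in> carrier F" "red_rep F S g = p @ word_power y n @ inv_word p"
    and "cyc_reduced y" "n \<ge> 1" "y = [] \<Longrightarrow> p = []"
  shows "hom_counting_qm F S (word_val F w) g = real n * cyclic_count_diff w y"
  unfolding hom_counting_qm_def using counting_qm_power_limit[OF assms] by (rule limI) simp

lemma hom_counting_qm_one:
  assumes "w \<in> reduced_words F S" "unbordered w"
  shows "hom_counting_qm F S (word_val F w) \<one> = 0"
proof -
  have "red_rep F S \<one> = []"
    by (rule red_rep_unique) (auto simp: reduced_words_def reduced_def word_val_def)
  then have "hom_counting_qm F S (word_val F w) \<one> = real 1 * cyclic_count_diff w []"
    using assms
    by (intro hom_counting_qm_eq[where p = "[]"]) (auto simp: cyc_reduced_def reduced_def inv_word_def)
  then show ?thesis by (simp add: cyclic_count_diff_def cyclic_count_def)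
qed

lemma hom_counting_qm_word:
  assumes "w \<in> reduced_words F S" "unbordered w" "cyc_reduced y"
  shows "hom_counting_qm F S (word_val F w) (word_val F y) = cyclic_count_diff w y"
proof -
  have "y \<in> reduced_words F S" using assms by (auto simp: cyc_reduced_def reduced_words_def)
  then have "red_rep F S (word_val F y) = [] @ word_power y 1 @ inv_word []"
    by (simp add: red_rep_unique inv_word_def)
  moreover have "word_val F y \<in> carrier F"
    using assms by (simp add: cyc_reduced_def word_val_closed)
  ultimately show ?thesis
    using hom_counting_qm_eq[OF assms(1,2), where g = "word_val F y" and p = "[]" and y = y and n = 1] assms(3) by simp
qed

text \<open>
  Inverting \<open>y\<close> exchanges the occurrences of \<open>w\<close> and of \<open>w\<inverse>\<close>. Passing to the limit along the powers of
  \<open>y\<close> reduces this to linear words, where the reflection of positions needs no modular arithmetic.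
\<close>

lemma cyclic_count_diff_inv_word:
  assumes w: "w \<in> reduced_words F S" "unbordered w" and y: "cyc_reduced y"
  shows "cyclic_count_diff w (inv_word y) = - cyclic_count_diff w y"
proof -
  have c: "word_val F y \<in> carrier F" and yS: "y \<in> lists S" and yr: "y \<in> reduced_words F S"
    using y by (auto simp: cyc_reduced_def word_val_closed reduced_words_def)
  have rr: "red_rep F S (word_val F y) = [] @ word_power y 1 @ inv_word []"
    using yr by (simp add: red_rep_unique inv_word_def)
  have "(\<lambda>k. counting_qm F S (word_val F w) (word_val F y [^] k) / real k) \<longlonglongrightarrow> cyclic_count_diff w y"
    using counting_qm_power_limit[OF w c rr y] by simp
  then have "(\<lambda>k. - (counting_qm F S (word_val F w) (word_val F y [^] k) / real k))
      \<longlonglongrightarrow> - cyclic_count_diff w y" by (rule tendsto_minus)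
  then have "(\<lambda>k. counting_qm F S (word_val F w) (inv (word_val F y) [^] k) / real k)
      \<longlonglongrightarrow> - cyclic_count_diff w y"
    using c w by (simp add: nat_pow_inv counting_qm_inv)
  then have "hom_counting_qm F S (word_val F w) (inv (word_val F y)) = - cyclic_count_diff w y"
    unfolding hom_counting_qm_def by (rule limI)
  then show ?thesis
    using hom_counting_qm_word[OF w cyc_reduced_inv_word[OF y]] yS
    by (simp add: word_val_inv_word del: in_lists_conv_set)
qed

lemma cyclic_count_diff_rotate: "cyclic_count_diff w (rotate k y) = cyclic_count_diff w y"
  by (simp add: cyclic_count_diff_def cyclic_count_rotate)

section \<open>The basis words\<close>

text \<open>
  The cyclic words of \<open>y\<close> and of its inverse: for cyclically reduced \<open>y\<close>, these spell the cyclically reduced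
  conjugates of \<open>y\<close> and of \<open>y\<inverse>\<close>.
\<close>

definition orbit :: "'a list \<Rightarrow> 'a list set" where
  "orbit y = range (\<lambda>k. rotate k y) \<union> range (\<lambda>k. rotate k (inv_word y))"

text \<open>
  Minimality also against the rotations of the inverse selects one representative from each pair of
  mutually inverse conjugacy classes.
\<close>

definition basis_words :: "('a \<times> 'a) set \<Rightarrow> 'a list set" where
  "basis_words R = {w. cyc_reduced w \<and> primitive w \<and> (\<forall>v\<in>orbit w. (v, w) \<notin> lex R)}"

lemma length_orbit: "v \<in> orbit y \<Longrightarrow> length v = length y"
  by (auto simp: orbit_def)

lemma inv_word_rotate:
  obtains j where "inv_word (rotate k y) = rotate j (inv_word y)"
proof
  define a and b where a_b_def: "a = take (k mod length y) y" "b = drop (k mod length y) y"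
  have "y = a @ b" "rotate k y = b @ a"
    by (simp_all add: a_b_def rotate_drop_take)
  then show "inv_word (rotate k y) = rotate (length (inv_word (drop (k mod length y) y))) (inv_word y)"
    by (metis a_b_def(2) inv_word_append rotate_append)
qed

lemma orbit_trans:
  assumes "y \<in> lists S" "v \<in> orbit y" "u \<in> orbit v"
  shows "u \<in> orbit y"
proof -
  have "inv_word v \<in> orbit y"
    using assms(2) unfolding orbit_def
  proof
    assume "v \<in> range (\<lambda>k. rotate k y)"
    then obtain k where "v = rotate k y" by blast
    then show "inv_word v \<in> range (\<lambda>k. rotate k y) \<union> range (\<lambda>k. rotate k (inv_word y))"
      using inv_word_rotate[of k y] by (metis UnCI rangeI)
  next
    assume "v \<in> range (\<lambda>k. rotate k (inv_word y))"
    then obtain k where "v = rotate k (inv_word y)" by blast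
    then show "inv_word v \<in> range (\<lambda>k. rotate k y) \<union> range (\<lambda>k. rotate k (inv_word y))"
      using inv_word_rotate[of k "inv_word y"] inv_word_inv_word[OF assms(1)] by (metis UnCI rangeI)
  qed
  then show ?thesis using assms(2,3) by (auto simp: orbit_def rotate_rotate)
qed

lemma orbit_sym:
  assumes "y \<in> lists S" "v \<in> orbit y"
  shows "y \<in> orbit v"
  using assms(2) unfolding orbit_def
proof
  assume "v \<in> range (\<lambda>k. rotate k y)"
  then obtain k where "v = rotate k y" by blast
  then show "y \<in> range (\<lambda>k. rotate k v) \<union> range (\<lambda>k. rotate k (inv_word v))"
    by (metis UnCI rangeI rotate_back)
next
  assume "v \<in> range (\<lambda>k. rotate k (inv_word y))"
  then obtain k where "v = rotate k (inv_word y)" by blast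
  then obtain j where "inv_word v = rotate j y"
    using inv_word_rotate[of k "inv_word y"] inv_word_inv_word[OF assms(1)] by metis
  then show "y \<in> range (\<lambda>k. rotate k v) \<union> range (\<lambda>k. rotate k (inv_word v))"
    by (metis UnCI rangeI rotate_back)
qed

lemma primitive_inv_word:
  assumes "y \<in> lists S" "primitive y"
  shows "primitive (inv_word y)"
  unfolding primitive_def
proof (intro conjI allI impI notI)
  fix u and n :: nat assume "2 \<le> n" "inv_word y = word_power u n"
  moreover from this have "y = word_power (inv_word u) n"
    using inv_word_inv_word[OF assms(1)] by (metis inv_word_power)
  ultimately show False using assms(2) by (auto simp: primitive_def)
qed (use assms in \<open>auto simp: primitive_def\<close>)

lemma basis_word_exists:
  assumes "wf R" "cyc_reduced y" "primitive y"
  obtains v where "v \<in> basis_words R" "y \<in> orbit v"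
proof -
  have yS: "y \<in> lists S" using assms by (simp add: cyc_reduced_def)
  have "rotate 0 y \<in> orbit y" unfolding orbit_def by blast
  then obtain v where v: "v \<in> orbit y" "\<And>u. (u, v) \<in> lex R \<Longrightarrow> u \<notin> orbit y"
    using wfE_min[OF wf_lex[OF assms(1)]] by metis
  have "cyc_reduced v" "primitive v"
    using v(1) assms primitive_inv_word[OF yS] cyc_reduced_inv_word
    by (auto simp: orbit_def cyc_reduced_rotate primitive_rotate)
  moreover have "(u, v) \<notin> lex R" if "u \<in> orbit v" for u
    using that v yS orbit_trans by blast
  ultimately show ?thesis
    using that[of v] orbit_sym[OF yS v(1)] by (simp add: basis_words_def)
qed

lemma basis_word_unique:
  assumes "total_on S R" "v \<in> basis_words R" "w \<in> basis_words R" "w \<in> orbit v"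
  shows "w = v"
proof -
  have S: "v \<in> lists S" "w \<in> lists S"
    using assms by (auto simp: basis_words_def cyc_reduced_def)
  then have "v \<in> orbit w" using assms(4) orbit_sym by blast
  then have "(v, w) \<notin> lex R" "(w, v) \<notin> lex R"
    using assms by (auto simp: basis_words_def)
  moreover have "total_on (set w \<union> set v) R"
    using assms(1) by (rule total_on_subset) (use S in auto)
  ultimately show ?thesis
    using lex_total_same_length length_orbit assms(4) by blast
qed

lemma basis_word_unbordered:
  assumes "total_on S R" "w \<in> basis_words R"
  shows "unbordered w"
proof (rule minimal_rotation_unbordered)
  show "primitive w" "(rotate k w, w) \<notin> lex R" for k
    using assms(2) by (auto simp: basis_words_def orbit_def)
  show "total_on (set w) R"
    using assms(1) by (rule total_on_subset) (use assms(2) in \<open>auto simp: basis_words_def cyc_reduced_def\<close>)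
qed

lemma basis_word_reduced: "w \<in> basis_words R \<Longrightarrow> w \<in> reduced_words F S"
  by (auto simp: basis_words_def cyc_reduced_def reduced_words_def)

text \<open>
  The normal form \<open>p y\<^sup>m p\<inverse>\<close> of a root \<open>u\<close> of \<open>w\<close> yields the reduced word \<open>p y\<^sup>m\<^sup>n p\<inverse>\<close> of \<open>u\<^sup>n\<close>, which
  must be \<open>w\<close>. As \<open>w\<close> is cyclically reduced, \<open>p\<close> is empty, and \<open>w\<close> is a proper power as a word, too.
\<close>

lemma indivisible_word_val:
  assumes "cyc_reduced w" "primitive w"
  shows "indivisible F (word_val F w)"
  unfolding indivisible_def
proof (intro conjI notI)
  have wr: "w \<in> reduced_words F S" using assms by (simp add: cyc_reduced_def reduced_words_def)
  have "w \<noteq> []" using assms by (simp add: primitive_def)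
  show ne: False if "word_val F w = \<one>"
  proof -
    have "red_rep F S \<one> = []"
      by (rule red_rep_unique) (auto simp: reduced_words_def reduced_def word_val_def)
    then show False using red_rep_unique[OF wr that] \<open>w \<noteq> []\<close> by simp
  qed
  assume "\<exists>u\<in>carrier F. \<exists>n::nat. n \<ge> 2 \<and> word_val F w = u [^] n"
  then obtain u and n :: nat where u: "u \<in> carrier F" "n \<ge> 2" "word_val F w = u [^] n" by blast
  with ne have "u \<noteq> \<one>" by auto
  then obtain p y m where y: "red_rep F S u = p @ word_power y m @ inv_word p"
      "cyc_reduced y" "primitive y" "m \<ge> 1"
    using conjugacy_normal_form u(1) by blast
  have rep: "p @ word_power y m @ inv_word p \<in> reduced_words F S"
      "word_val F (p @ word_power y m @ inv_word p) = u"
    using red_rep_in[OF u(1)] word_val_red_rep[OF u(1)] y(1) by simp_all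
  have "y \<noteq> []" using y by (simp add: primitive_def)
  then have "red_rep F S (u [^] n) = p @ word_power y (m * n) @ inv_word p"
    using red_rep_conj_power[OF rep(1) y(2,4), of n] u(2) rep(2) by simp
  then have w: "w = p @ word_power y (m * n) @ inv_word p"
    using red_rep_unique[OF wr u(3)] by simp
  show False
  proof (cases "p = []")
    case True
    moreover have "m * n \<ge> 2" using mult_le_mono[OF y(4) u(2)] by simp
    ultimately show False using w assms(2) by (auto simp: primitive_def inv_word_def)
  next
    case False
    then have "hd w = hd p" "last w = inv (hd p)"
      using w by (simp_all add: last_append inv_word_def last_rev hd_map)
    moreover have "hd p \<in> S" using rep False by (auto simp: reduced_words_def)
    ultimately show False
      using assms(1) \<open>w \<noteq> []\<close> letters_closed by (auto simp: cyc_reduced_def)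
  qed
qed

lemma basis_word_effective:
  assumes "w \<in> basis_words (r - Id)"
  shows "effective F S r (word_val F w)"
proof -
  have w: "cyc_reduced w" "primitive w" using assms by (auto simp: basis_words_def)
  have wr: "w \<in> reduced_words F S" using assms by (rule basis_word_reduced)
  then have rep: "red_rep F S (word_val F w) = w" by (simp add: red_rep_unique)
  have "\<not> lex_less F S r v (word_val F w)" if "v \<in> cyclic_class F S (word_val F w)" for v
  proof -
    from that obtain k where k: "v = word_val F (rotate k w)"
      by (auto simp: cyclic_class_def rep)
    have "rotate k w \<in> reduced_words F S"
      using cyc_reduced_rotate[OF w(1)] by (simp add: cyc_reduced_def reduced_words_def)
    then have "red_rep F S v = rotate k w" by (simp add: k red_rep_unique)
    moreover have "(rotate k w, w) \<notin> lex (r - Id)"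
      using assms by (auto simp: basis_words_def orbit_def)
    ultimately show ?thesis by (simp add: lex_less_def rep lexord_lex)
  qed
  then show ?thesis
    using w indivisible_word_val[OF w] 
    by (auto simp: effective_def cyclically_reduced_def rep word_val_closed cyc_reduced_def)
qed

section \<open>Triangularity\<close>

lemma cyclic_count_diff_self:
  assumes "total_on S R" "w \<in> basis_words R"
  shows "cyclic_count_diff w w = 1"
proof -
  have w: "w \<in> lists S" "reduced F w" "w \<noteq> []" "primitive w"
    using assms by (auto simp: basis_words_def cyc_reduced_def primitive_def)
  have "\<not> occurs_cyclically (inv_word w) w i" for i
    using inv_word_not_rotation[OF w(1-3)] by (simp add: occurs_cyclically_iff_take_rotate)
  then have "cyclic_count (inv_word w) w = 0" by (simp add: cyclic_count_def)
  then show ?thesis by (simp add: cyclic_count_diff_def cyclic_count_self w(4))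
qed

lemma cyclic_count_diff_nonzero:
  assumes "unbordered w" "w \<in> lists S" "cyclic_count_diff w v \<noteq> 0"
  obtains i where "i < length v" "length w \<le> length v"
    "w = take (length w) (rotate i v) \<or> inv_word w = take (length w) (rotate i v)"
proof -
  have "cyclic_count w v \<noteq> 0 \<or> cyclic_count (inv_word w) v \<noteq> 0"
    using assms(3) by (auto simp: cyclic_count_diff_def)
  then obtain u where u: "u = w \<or> u = inv_word w" "cyclic_count u v \<noteq> 0" by blast
  then have "unbordered u" "length u = length w"
    using assms unbordered_inv_word by auto
  then have le: "length u \<le> length v" using unbordered_cyclic_count_length u by blast
  obtain i where "i < length v" "occurs_cyclically u v i"
    using u(2) by (auto simp: cyclic_count_def)
  with le u(1) \<open>length u = length w\<close> show ?thesis
    by (intro that[of i]) (auto simp: occurs_cyclically_iff_take_rotate)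
qed

lemma cyclic_count_diff_triangular:
  assumes R: "total_on S R" and v: "v \<in> basis_words R" and w: "w \<in> basis_words R"
    and "cyclic_count_diff w v \<noteq> 0"
  shows "w = v \<or> length w < length v"
proof -
  have wS: "w \<in> lists S" "v \<in> lists S" using v w by (auto simp: basis_words_def cyc_reduced_def)
  obtain i where i: "length w \<le> length v"
      "w = take (length w) (rotate i v) \<or> inv_word w = take (length w) (rotate i v)"
    using cyclic_count_diff_nonzero[OF basis_word_unbordered[OF R w] wS(1) assms(4)] by blast
  show ?thesis
  proof (cases "length w = length v")
    case True
    then have "rotate i v = w \<or> rotate i v = inv_word w" using i by auto
    moreover have "rotate i v \<in> orbit v" by (simp add: orbit_def)
    moreover have "rotate 0 w \<in> orbit w" "rotate 0 (inv_word w) \<in> orbit w"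
      unfolding orbit_def by blast+
    ultimately have "w \<in> orbit v"
      using orbit_sym[OF wS(1)] orbit_trans[OF wS(2)] by auto
    then show ?thesis using basis_word_unique[OF R v w] by simp
  qed (use i in simp)
qed

text \<open>
  The alphabet may be infinite, but \<open>w\<close> or its inverse must be a prefix of one of the finitely many
  rotations of \<open>v\<close>.
\<close>

lemma finite_cyclic_count_diff_nonzero:
  assumes "v \<in> lists S"
  shows "finite {w \<in> lists S. unbordered w \<and> cyclic_count_diff w v \<noteq> 0}"
proof -
  define A where "A = (\<lambda>(l, i). take l (rotate i v)) ` ({..length v} \<times> {..<length v})"
  have "w \<in> A \<union> inv_word ` A"
    if w: "w \<in> lists S" "unbordered w" "cyclic_count_diff w v \<noteq> 0" for w
  proof -
    obtain i where "i < length v" "length w \<le> length v"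
      "w = take (length w) (rotate i v) \<or> inv_word w = take (length w) (rotate i v)"
      using cyclic_count_diff_nonzero[OF w(2,1,3)] .
    then have "w \<in> A \<or> inv_word w \<in> A" by (auto simp: A_def image_iff)
    then show ?thesis using inv_word_inv_word[OF w(1)] by (metis UnCI image_eqI)
  qed
  then have "{w \<in> lists S. unbordered w \<and> cyclic_count_diff w v \<noteq> 0} \<subseteq> A \<union> inv_word ` A" by blast
  then show ?thesis by (rule finite_subset) (simp add: A_def)
qed

text \<open>
  The factor \<open>t\<close> is the exponent \<open>m\<close> for which \<open>g\<close> is conjugate to the \<open>m\<close>-th power of the basis word.
  All functions involved are homogeneous and invariant under conjugation, so at every element they
  take a common multiple of their values at some basis word.
\<close>

lemma values_from_basis_word:
  assumes "wf R" "g \<in> carrier F" "g \<noteq> \<one>"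
  obtains v t where "v \<in> basis_words R"
    "\<And>\<phi>. homogeneous_quasimorphism F \<phi> \<Longrightarrow> \<phi> g = t * \<phi> (word_val F v)"
    "\<And>w. w \<in> reduced_words F S \<Longrightarrow> unbordered w \<Longrightarrow>
       hom_counting_qm F S (word_val F w) g = t * cyclic_count_diff w v"
proof -
  obtain p y n where y: "red_rep F S g = p @ word_power y n @ inv_word p"
      "cyc_reduced y" "primitive y" "n \<ge> 1"
    using conjugacy_normal_form[OF assms(2,3)] .
  obtain v where v: "v \<in> basis_words R" "y \<in> orbit v"
    using basis_word_exists[OF assms(1) y(2,3)] .
  have vS: "v \<in> lists S" "cyc_reduced v" using v by (auto simp: basis_words_def cyc_reduced_def)
  have yS: "y \<in> lists S" and "y \<noteq> []" using y by (auto simp: cyc_reduced_def primitive_def)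
  \<comment> \<open>The sign \<open>e\<close> records whether \<open>y\<close> lies in the class of \<open>v\<close> or in that of its inverse.\<close>
  obtain e :: real and k where e: "y = rotate k v \<and> e = 1 \<or> y = rotate k (inv_word v) \<and> e = - 1"
    using v(2) by (auto simp: orbit_def)
  have p: "p \<in> lists S" "inv_word p \<in> lists S"
    using red_rep_in[OF assms(2)] y(1) by (auto simp: reduced_words_def)
  have g: "g = word_val F p \<otimes> word_val F y [^] n \<otimes> inv (word_val F p)"
    using word_val_red_rep[OF assms(2)] p yS word_power_lists[OF yS, of n] word_val_closed[OF p(1)]
      word_val_closed[OF yS]
    by (simp add: y(1) word_val_append word_val_inv_word word_val_power m_assoc del: in_lists_conv_set)
  show ?thesis
  proof (rule that[OF v(1)])
    fix \<phi> assume \<phi>: "homogeneous_quasimorphism F \<phi>"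
    have "\<phi> g = real n * \<phi> (word_val F y)"
      unfolding g using word_val_closed[OF p(1)] word_val_closed[OF yS]
      by (simp add: homogeneous_quasimorphism_conjugate[OF \<phi>] homogeneous_quasimorphism_nat_pow[OF \<phi>])
    moreover have rot: "\<phi> (word_val F (rotate k u)) = \<phi> (word_val F u)" if u: "u \<in> lists S" for u k
    proof -
      obtain h where "h \<in> carrier F" "word_val F (rotate k u) = h \<otimes> word_val F u \<otimes> inv h"
        using word_val_rotate_conjugate[OF u] .
      then show ?thesis
        using homogeneous_quasimorphism_conjugate[OF \<phi>] word_val_closed[OF u] by simp
    qed
    have "\<phi> (word_val F y) = e * \<phi> (word_val F v)"
      using e rot[OF vS(1)] rot[OF inv_word_lists[OF vS(1)]] homogeneous_quasimorphism_inv[OF \<phi>]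
        word_val_closed[OF vS(1)]
      by (auto simp: word_val_inv_word[OF vS(1)])
    ultimately show "\<phi> g = (real n * e) * \<phi> (word_val F v)" by simp
  next
    fix w assume w: "w \<in> reduced_words F S" "unbordered w"
    have "hom_counting_qm F S (word_val F w) g = real n * cyclic_count_diff w y"
      using hom_counting_qm_eq[OF w assms(2) y(1,2,4)] \<open>y \<noteq> []\<close> by simp
    also have "cyclic_count_diff w y = e * cyclic_count_diff w v"
      using e by (auto simp: cyclic_count_diff_rotate cyclic_count_diff_inv_word[OF w vS(2)])
    finally show "hom_counting_qm F S (word_val F w) g = (real n * e) * cyclic_count_diff w v" by simp
  qed
qed

end

theorem theorem1p3:
  fixes F :: "('a, 'b) monoid_scheme" and S :: "'a set" and r :: "('a \<times> 'a) set"
  assumes "group F"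
    and "symmetric_free_generating_set F S"
    and "well_order_on S r"
  shows "\<exists>B. (\<forall>w\<in>B. effective F S r w) \<and>
    lin_independent_family (carrier F) B (hom_counting_qm F S) \<and>
    (\<forall>\<phi>. homogeneous_quasimorphism F \<phi> \<longrightarrow>
      (\<exists>c :: 'a \<Rightarrow> real. \<forall>g\<in>carrier F.
        finite {w \<in> B. c w * hom_counting_qm F S w g \<noteq> 0} \<and>
        \<phi> g = (\<Sum>w | w \<in> B \<and> c w * hom_counting_qm F S w g \<noteq> 0. c w * hom_counting_qm F S w g)))"
proof -
  interpret free_group_words F S
    using assms(1,2) by (simp add: free_group_words_def free_group_words_axioms_def)
  define R where "R = r - Id"
  have R: "wf R" "total_on S R"
    using assms(3) by (auto simp: well_order_on_def linear_order_on_def total_on_def R_def)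
  define B where "B = word_val F ` basis_words R"
  define f where "f = hom_counting_qm F S"
  define len where "len g = length (red_rep F S g)" for g
  have rep: "red_rep F S (word_val F w) = w" if "w \<in> basis_words R" for w
    using basis_word_reduced[OF that] by (simp add: red_rep_unique)
  have f: "f (word_val F w) (word_val F v) = cyclic_count_diff w v"
    if "w \<in> basis_words R" "v \<in> basis_words R" for w v
    unfolding f_def
    using that basis_word_reduced basis_word_unbordered[OF R(2)]
    by (intro hom_counting_qm_word) (auto simp: basis_words_def)
  have BC: "B \<subseteq> carrier F"
    using basis_word_reduced word_val_closed by (auto simp: B_def reduced_words_def)
  have diag: "f v v = 1" if "v \<in> B" for v
    using that f cyclic_count_diff_self[OF R(2)] by (auto simp: B_def)
  have tri: "w = v \<or> len w < len v" if vw: "v \<in> B" "w \<in> B" "f w v \<noteq> 0" for v w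
  proof -
    obtain x y where xy: "x \<in> basis_words R" "v = word_val F x" "y \<in> basis_words R" "w = word_val F y"
      using vw unfolding B_def by blast
    then have "y = x \<or> length y < length x"
      using vw f cyclic_count_diff_triangular[OF R(2)] by simp
    then show ?thesis using xy rep by (auto simp: len_def)
  qed
  have fin: "finite {w \<in> B. f w v \<noteq> 0}" if v: "v \<in> B" for v
  proof -
    obtain x where x: "x \<in> basis_words R" "v = word_val F x" using v unfolding B_def by blast
    have "{w \<in> B. f w v \<noteq> 0}
        \<subseteq> word_val F ` {w \<in> lists S. unbordered w \<and> cyclic_count_diff w x \<noteq> 0}"
      using f x basis_word_unbordered[OF R(2)] basis_word_reduced
      by (auto simp: B_def reduced_words_def)
    moreover have "x \<in> lists S" using x by (auto simp: basis_words_def cyc_reduced_def)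
    ultimately show ?thesis
      using finite_cyclic_count_diff_nonzero by (meson finite_imageI finite_subset)
  qed
  have "\<exists>c :: 'a \<Rightarrow> real. \<forall>g\<in>carrier F. finite {w \<in> B. c w * f w g \<noteq> 0} \<and>
      \<phi> g = (\<Sum>w | w \<in> B \<and> c w * f w g \<noteq> 0. c w * f w g)"
    if \<phi>: "homogeneous_quasimorphism F \<phi>" for \<phi>
  proof -
    obtain c where c: "\<And>v. v \<in> B \<Longrightarrow> \<phi> v = (\<Sum>w | w \<in> B \<and> f w v \<noteq> 0. c w * f w v)"
      using triangular_coefficients[of B f len \<phi>, OF diag tri fin] by blast
    have "finite {w \<in> B. c w * f w g \<noteq> 0} \<and>
        \<phi> g = (\<Sum>w | w \<in> B \<and> c w * f w g \<noteq> 0. c w * f w g)" if g: "g \<in> carrier F" for g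
    proof (cases "g = \<one>\<^bsub>F\<^esub>")
      case True
      have "f w g = 0" if "w \<in> B" for w
        using that True hom_counting_qm_one basis_word_reduced basis_word_unbordered[OF R(2)]
        by (auto simp: f_def B_def)
      then have "{w \<in> B. c w * f w g \<noteq> 0} = {}" by auto
      moreover have "\<phi> g = 0"
        using homogeneous_quasimorphism_nat_pow[OF \<phi> g, of 0] True by simp
      ultimately show ?thesis by (simp only: finite.emptyI sum.empty simp_thms)
    next
      case False
      obtain x t where x: "x \<in> basis_words R" "\<phi> g = t * \<phi> (word_val F x)"
        "\<And>w. w \<in> reduced_words F S \<Longrightarrow> unbordered w \<Longrightarrow>
           hom_counting_qm F S (word_val F w) g = t * cyclic_count_diff w x"
        using values_from_basis_word[OF R(1) g False] \<phi> by metis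
      define v where "v = word_val F x"
      have v: "v \<in> B" using x by (simp add: v_def B_def)
      have scale: "f w g = t * f w v" if "w \<in> B" for w
        using that x f basis_word_reduced basis_word_unbordered[OF R(2)]
        by (auto simp: B_def v_def f_def)
      have sub: "{w \<in> B. c w * f w g \<noteq> 0} \<subseteq> {w \<in> B. f w v \<noteq> 0}"
        using scale by auto
      have "\<phi> g = (\<Sum>w | w \<in> B \<and> f w v \<noteq> 0. t * (c w * f w v))"
        using x(2) c[OF v] by (simp add: v_def sum_distrib_left)
      also have "\<dots> = (\<Sum>w | w \<in> B \<and> f w v \<noteq> 0. c w * f w g)"
        by (intro sum.cong) (auto simp: scale)
      also have "\<dots> = (\<Sum>w | w \<in> B \<and> c w * f w g \<noteq> 0. c w * f w g)"
        using fin[OF v] sub by (intro sum.mono_neutral_right) auto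
      finally show ?thesis using finite_subset[OF sub fin[OF v]] by blast
    qed
    then show ?thesis by blast
  qed
  moreover have "lin_independent_family (carrier F) B f"
    by (rule triangular_lin_independent[where size = len]) (use diag tri BC in auto)
  moreover have "\<forall>w\<in>B. effective F S r w"
    using basis_word_effective by (auto simp: B_def R_def)
  ultimately show ?thesis unfolding f_def by blast
qed

end
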